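(* Let $N=\{1,\dots,n\}$ be a finite set of agents, $O=\{o_1,\dots,o_n\}$ a set of $n$ objects with $o_i$ the endowment of agent $i$, $\mathcal{P}$ the set of all strict linear orders on $O$, and $\mathcal{X}$ the set of allocations (bijections $N\to O$). Suppose $\mathcal{D}\subseteq\mathcal{P}$ satisfies the top-two condition, and let $\varphi:\mathcal{D}^N\to\mathcal{X}$ be a rule. Then the following are equivalent: (i) $\varphi$ is the TTC rule, i.e. $\varphi(P)=TTC(P)$ for every $P\in\mathcal{D}^N$. (ii) $\varphi$ is individually rational, Pareto efficient, and strategyproof. (iii) $\varphi$ is individually rational, pair efficient, and strategyproof.
   Context: Setting. $N=\{1,\dots,n\}$ is a finite set of agents and $O=\{o_1,\dots,o_n\}$ a set of $n$ distinct objects; $o_i$ is agent $i$'s endowment. $\mathcal{P}$ is the set of all strict linear orders over $O$; a domain is a subset $\mathcal{D}\subseteq\mathcal{P}$ (all inclusions are weak). A preference profile is $P=(P_i)_{i\in N}\in\mathcal{D}^N$. For $P_0\in\mathcal{D}$, $a\mathrel{P_0}b$ means $a$ is strictly preferred to $b$, and $a\mathrel{R_0}b$ means $a\mathrel{P_0}b$ or $a=b$. $(P_i',P_{-i})$ denotes the profile $P$ with agent $i$'s preference replaced by $P_i'$. An allocation is a bijection $x:N\to O$, with $x_i=x(i)$; $\mathcal{X}$ is the set of allocations. A rule is a function $\varphi:\mathcal{D}^N\to\mathcal{X}$, and $\varphi_i(P)$ is the object assigned to $i$. Ranks. For $O'\subseteq O$ and $P_0\in\mathcal{D}$, $r_k(P_0,O')$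 is the object of $O'$ ranked $k$-th by $P_0$ restricted to $O'$. $r_1(\mathcal{D},O')=\{r_1(P_0,O'):P_0\in\mathcal{D}\}$. Top-two condition. $\mathcal{D}$ satisfies the top-two condition within $O'\subseteq O$ if for any distinct $a,b\in r_1(\mathcal{D},O')$ there is $P_0\in\mathcal{D}$ with $a=r_1(P_0,O')$ and $b=r_2(P_0,O')$. $\mathcal{D}$ satisfies the top-two condition if it satisfies it within every $O'\subseteq O$. Axioms. A rule $\varphi$ is individually rational if for all $P\in\mathcal{D}^N$ and $i\in N$, $\varphi_i(P)\mathrel{R_i}o_i$. It is Pareto efficient if for each $P\in\mathcal{D}^N$ there is no $y\in\mathcal{X}$ with $y_i\mathrel{R_i}\varphi_i(P)$ for all $i\in N$ and $y_j\mathrel{P_j}\varphi_j(P)$ for some $j\in N$. It is pair efficient if for each $P\in\mathcal{D}^N$ there are no $i,j\in N$ with $\varphi_j(P)\mathrel{P_i}\varphi_i(P)$ and $\varphi_i(P)\mathrel{P_j}\varphi_j(P)$. It is strategyproof if for all $P\in\mathcal{D}^N$, there are no $i\in N$ and $P_i'\in\mathcal{D}$ with $\varphi_i(P_i',P_{-i})\mathrel{P_i}\varphi_i(P)$. TTC. For $P\in\mathcal{P}^N$, the allocation $TTC(P)$ is produced by the Top Trading Cycles algorithm: (1) each agent points to the agent who owns their most-preferred object (among those remaining); (2) the resulting directed graph has at least one cycle (self-loops count as cycles); all agents belonging to cycles are assigned the objects they point to and leave, with those objects; (3) repeat with the remaining agents and objects until none remain. The TTC rule on $\mathcal{D}$ is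 $P\mapsto TTC(P)$ on $\mathcal{D}^N$. *)

theory Defs
  imports Main
begin

text \<open>
  Agents and objects are types \<open>'i\<close> and \<open>'o\<close> (finiteness of \<open>'i\<close> is required where it
  matters); the endowment is a bijection \<open>\<omega> :: 'i \<Rightarrow> 'o\<close>, so agent \<open>i\<close> owns \<open>\<omega> i\<close>.
  A preference is a strict linear order \<open>r :: 'o rel\<close>, with \<open>(a, b) \<in> r\<close> meaning that \<open>a\<close> is
  strictly preferred to \<open>b\<close>; \<open>r\<^sup>=\<close> is then the associated weak preference.
\<close>

definition preferences :: "'o rel set" where
  "preferences = {r. strict_linear_order r}"

definition profiles :: "'o rel set \<Rightarrow> ('i \<Rightarrow> 'o rel) set" where
  "profiles D = {P. \<forall>i. P i \<in> D}"

definition allocations :: "('i \<Rightarrow> 'o) set" where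
  "allocations = {x. bij x}"

text \<open>The values of a rule on \<open>D\<close> outside \<open>profiles D\<close> are irrelevant in everything below.\<close>

definition is_rule :: "'o rel set \<Rightarrow> (('i \<Rightarrow> 'o rel) \<Rightarrow> 'i \<Rightarrow> 'o) \<Rightarrow> bool" where
  "is_rule D \<phi> \<longleftrightarrow> (\<forall>P \<in> profiles D. \<phi> P \<in> allocations)"

text \<open>
  Ranks are counted from \<open>1\<close>: the \<open>k\<close>-th ranked object of \<open>A\<close> is the one with exactly \<open>k\<close>
  objects of \<open>A\<close> weakly preferred to it.
\<close>

definition ranked :: "nat \<Rightarrow> 'o rel \<Rightarrow> 'o set \<Rightarrow> 'o" where
  "ranked k r A = (THE a. a \<in> A \<and> card {b \<in> A. (b, a) \<in> r\<^sup>=} = k)"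

definition top_two_within :: "'o rel set \<Rightarrow> 'o set \<Rightarrow> bool" where
  "top_two_within D A \<longleftrightarrow>
     (\<forall>a \<in> (\<lambda>r. ranked 1 r A) ` D. \<forall>b \<in> (\<lambda>r. ranked 1 r A) ` D.
        a \<noteq> b \<longrightarrow> (\<exists>r \<in> D. a = ranked 1 r A \<and> b = ranked 2 r A))"

definition top_two :: "'o rel set \<Rightarrow> bool" where
  "top_two D \<longleftrightarrow> (\<forall>A. top_two_within D A)"

definition individually_rational ::
  "('i \<Rightarrow> 'o) \<Rightarrow> 'o rel set \<Rightarrow> (('i \<Rightarrow> 'o rel) \<Rightarrow> 'i \<Rightarrow> 'o) \<Rightarrow> bool" where
  "individually_rational \<omega> D \<phi> \<longleftrightarrow>
     (\<forall>P \<in> profiles D. \<forall>i. (\<phi> P i, \<omega> i) \<in> (P i)\<^sup>=)"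

definition pareto_efficient ::
  "'o rel set \<Rightarrow> (('i \<Rightarrow> 'o rel) \<Rightarrow> 'i \<Rightarrow> 'o) \<Rightarrow> bool" where
  "pareto_efficient D \<phi> \<longleftrightarrow>
     (\<forall>P \<in> profiles D. \<not> (\<exists>y \<in> allocations.
        (\<forall>i. (y i, \<phi> P i) \<in> (P i)\<^sup>=) \<and> (\<exists>j. (y j, \<phi> P j) \<in> P j)))"

definition pair_efficient ::
  "'o rel set \<Rightarrow> (('i \<Rightarrow> 'o rel) \<Rightarrow> 'i \<Rightarrow> 'o) \<Rightarrow> bool" where
  "pair_efficient D \<phi> \<longleftrightarrow>
     (\<forall>P \<in> profiles D. \<not> (\<exists>i j. (\<phi> P j, \<phi> P i) \<in> P i \<and> (\<phi> P i, \<phi> P j) \<in> P j))"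

definition strategyproof ::
  "'o rel set \<Rightarrow> (('i \<Rightarrow> 'o rel) \<Rightarrow> 'i \<Rightarrow> 'o) \<Rightarrow> bool" where
  "strategyproof D \<phi> \<longleftrightarrow>
     (\<forall>P \<in> profiles D. \<not> (\<exists>i. \<exists>r \<in> D. (\<phi> (P(i := r)) i, \<phi> P i) \<in> P i))"

text \<open>
  \<open>S\<close> is the set of agents still present; the objects still present are then \<open>\<omega> ` S\<close>.
\<close>

definition points_to :: "('i \<Rightarrow> 'o) \<Rightarrow> ('i \<Rightarrow> 'o rel) \<Rightarrow> 'i set \<Rightarrow> 'i \<Rightarrow> 'i" where
  "points_to \<omega> P S i = inv \<omega> (ranked 1 (P i) (\<omega> ` S))"

text \<open>Every agent points to exactly one agent, so lying on a cycle is being a periodic point.\<close>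

definition cycle_agents :: "('i \<Rightarrow> 'o) \<Rightarrow> ('i \<Rightarrow> 'o rel) \<Rightarrow> 'i set \<Rightarrow> 'i set" where
  "cycle_agents \<omega> P S = {i \<in> S. \<exists>k > 0. (points_to \<omega> P S ^^ k) i = i}"

primrec remaining :: "('i \<Rightarrow> 'o) \<Rightarrow> ('i \<Rightarrow> 'o rel) \<Rightarrow> nat \<Rightarrow> 'i set" where
  "remaining \<omega> P 0 = UNIV"
| "remaining \<omega> P (Suc t) = remaining \<omega> P t - cycle_agents \<omega> P (remaining \<omega> P t)"

definition exit_round :: "('i \<Rightarrow> 'o) \<Rightarrow> ('i \<Rightarrow> 'o rel) \<Rightarrow> 'i \<Rightarrow> nat" where
  "exit_round \<omega> P i = (THE t. i \<in> cycle_agents \<omega> P (remaining \<omega> P t))"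

definition TTC :: "('i \<Rightarrow> 'o) \<Rightarrow> ('i \<Rightarrow> 'o rel) \<Rightarrow> 'i \<Rightarrow> 'o" where
  "TTC \<omega> P i = ranked 1 (P i) (\<omega> ` remaining \<omega> P (exit_round \<omega> P i))"


text \<open>The definite descriptions above are well defined, and \<open>TTC\<close> yields an allocation.\<close>

lemma ranked_ex1:
  assumes r: "strict_linear_order r" and fin: "finite A" and k: "1 \<le> k" "k \<le> card A"
  shows "\<exists>!a. a \<in> A \<and> card {b \<in> A. (b, a) \<in> r\<^sup>=} = k"
proof -
  let ?f = "\<lambda>a. card {b \<in> A. (b, a) \<in> r\<^sup>=}"
  have tr: "trans r" and irr: "irrefl r" and tot: "total r"
    using r by (auto simp: strict_linear_order_on_def)
  have less: "?f a < ?f a'" if "a \<in> A" "a' \<in> A" "(a, a') \<in> r" for a a'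
  proof (rule psubset_card_mono)
    show "finite {b \<in> A. (b, a') \<in> r\<^sup>=}" using fin by simp
    have "(a', a) \<notin> r" "a \<noteq> a'"
      using that(3) tr irr by (auto dest: transD simp: irrefl_def)
    then show "{b \<in> A. (b, a) \<in> r\<^sup>=} \<subset> {b \<in> A. (b, a') \<in> r\<^sup>=}"
      using that tr by (auto dest: transD)
  qed
  have inj: "inj_on ?f A"
  proof (rule inj_onI, rule ccontr)
    fix a a' assume "a \<in> A" "a' \<in> A" "?f a = ?f a'" "a \<noteq> a'"
    then show False
      using less[of a a'] less[of a' a] tot by (auto simp: total_on_def)
  qed
  have "?f ` A \<subseteq> {1..card A}"
  proof
    fix m assume "m \<in> ?f ` A"
    then obtain a where a: "a \<in> A" "m = ?f a" by blast
    have "?f a \<le> card A" by (rule card_mono[OF fin]) auto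
    moreover have "?f a \<noteq> 0" using fin a(1) by auto
    ultimately show "m \<in> {1..card A}" using a by simp
  qed
  then have "?f ` A = {1..card A}"
    using inj by (intro card_subset_eq) (auto simp: card_image)
  then have "k \<in> ?f ` A" using k by auto
  then show ?thesis using inj by (auto simp: inj_on_def)
qed

lemma ranked_1_in:
  assumes "strict_linear_order r" "finite A" "A \<noteq> {}"
  shows "ranked 1 r A \<in> A"
proof -
  have "1 \<le> card A" using assms by (simp add: Suc_le_eq card_gt_0_iff)
  from theI'[OF ranked_ex1[OF assms(1,2) _ this]] show ?thesis
    by (simp add: ranked_def)
qed

lemma points_to_in:
  fixes \<omega> :: "'i::finite \<Rightarrow> 'o"
  assumes "bij \<omega>" "strict_linear_order (P i)" "S \<noteq> {}"
  shows "points_to \<omega> P S i \<in> S" "\<omega> (points_to \<omega> P S i) = ranked 1 (P i) (\<omega> ` S)"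
proof -
  have "ranked 1 (P i) (\<omega> ` S) \<in> \<omega> ` S"
    using assms by (intro ranked_1_in) auto
  then show "points_to \<omega> P S i \<in> S" "\<omega> (points_to \<omega> P S i) = ranked 1 (P i) (\<omega> ` S)"
    using assms(1) by (auto simp: points_to_def bij_is_inj)
qed

lemma cycle_agents_nonempty:
  fixes \<omega> :: "'i::finite \<Rightarrow> 'o"
  assumes "bij \<omega>" "\<And>i. strict_linear_order (P i)" "S \<noteq> {}"
  shows "cycle_agents \<omega> P S \<noteq> {}"
proof -
  let ?f = "points_to \<omega> P S"
  obtain a where a: "a \<in> S" using assms(3) by blast
  have inS: "(?f ^^ n) a \<in> S" for n
    using a points_to_in(1)[OF assms(1,2,3)] by (induction n) auto
  have "\<not> inj (\<lambda>n. (?f ^^ n) a)"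
    using finite_imageD[of "\<lambda>n. (?f ^^ n) a" UNIV] by auto
  then obtain m n where "m < n" "(?f ^^ m) a = (?f ^^ n) a"
    unfolding inj_def by (metis linorder_neqE_nat)
  moreover from \<open>m < n\<close> have "(?f ^^ n) a = (?f ^^ (n - m)) ((?f ^^ m) a)"
    using funpow_add[of "n - m" m ?f] by simp
  ultimately have "(?f ^^ (n - m)) ((?f ^^ m) a) = (?f ^^ m) a" "n - m > 0"
    by simp_all
  then show ?thesis using inS[of m] unfolding cycle_agents_def by blast
qed

lemma remaining_antimono: "s \<le> t \<Longrightarrow> remaining \<omega> P t \<subseteq> remaining \<omega> P s"
  by (rule lift_Suc_antimono_le) auto

lemma exit_round_ex1:
  fixes \<omega> :: "'i::finite \<Rightarrow> 'o"
  assumes "bij \<omega>" "\<And>i. strict_linear_order (P i)"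
  shows "\<exists>!t. i \<in> cycle_agents \<omega> P (remaining \<omega> P t)"
proof -
  let ?R = "remaining \<omega> P" and ?C = "\<lambda>t. cycle_agents \<omega> P (remaining \<omega> P t)"
  have sub: "?C t \<subseteq> ?R t" for t by (auto simp: cycle_agents_def)
  have bound: "card (?R t) \<le> card (UNIV :: 'i set) - t" for t
  proof (induction t)
    case (Suc t)
    show ?case
    proof (cases "?R t = {}")
      case False
      then have "?R (Suc t) \<subset> ?R t"
        using cycle_agents_nonempty[where P = P, OF assms False] sub[of t] by auto
      then have "card (?R (Suc t)) < card (?R t)" by (intro psubset_card_mono) auto
      with Suc show ?thesis by simp
    qed simp
  qed simp
  have "?R (card (UNIV :: 'i set)) = {}" using bound[of "card (UNIV :: 'i set)"] by simp
  moreover have "i \<in> ?R t" if "\<forall>s. i \<notin> ?C s" for t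
    using that by (induction t) auto
  ultimately have "\<exists>t. i \<in> ?C t" by blast
  moreover have "s = t" if "i \<in> ?C s" "i \<in> ?C t" for s t
  proof -
    have "False" if "i \<in> ?C s" "i \<in> ?C t" "s < t" for s t
      using that sub[of t] remaining_antimono[of "Suc s" t \<omega> P] by auto
    with that show ?thesis by (metis linorder_neqE_nat)
  qed
  ultimately show ?thesis by blast
qed

lemma TTC_allocation:
  fixes \<omega> :: "'i::finite \<Rightarrow> 'o"
  assumes "bij \<omega>" "\<And>i. strict_linear_order (P i)"
  shows "TTC \<omega> P \<in> allocations"
proof -
  let ?R = "remaining \<omega> P" and ?t = "exit_round \<omega> P"
  let ?f = "\<lambda>i. points_to \<omega> P (?R (?t i)) i"
  have cyc: "i \<in> cycle_agents \<omega> P (?R (?t i))" for i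
    unfolding exit_round_def by (rule theI'[OF exit_round_ex1[where P = P, OF assms]])
  have round: "?t i = t" if "i \<in> cycle_agents \<omega> P (?R t)" for i t
    using exit_round_ex1[where P = P, OF assms] cyc that by blast
  have ne: "?R (?t i) \<noteq> {}" for i using cyc[of i] by (auto simp: cycle_agents_def)
  have T: "TTC \<omega> P i = \<omega> (?f i)" for i
    using points_to_in(2)[where P = P, OF assms ne] by (simp add: TTC_def)
  have succ: "?f i \<in> cycle_agents \<omega> P (?R (?t i))" for i
  proof -
    obtain k where "k > 0" "(points_to \<omega> P (?R (?t i)) ^^ k) i = i"
      using cyc[of i] by (auto simp: cycle_agents_def)
    then have "(points_to \<omega> P (?R (?t i)) ^^ k) (?f i) = ?f i"
      by (metis funpow_swap1)
    with \<open>k > 0\<close> points_to_in(1)[where P = P, OF assms ne] show ?thesis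
      by (auto simp: cycle_agents_def)
  qed
  note same = round[OF succ]
  have "inj ?f"
  proof (rule injI)
    fix i j assume eq: "?f i = ?f j"
    then have t: "?t i = ?t j" using same by metis
    let ?g = "points_to \<omega> P (?R (?t i))"
    obtain k l where k: "k > 0" "(?g ^^ k) i = i" and l: "l > 0" "(?g ^^ l) j = j"
      using cyc[of i] cyc[of j] t by (auto simp: cycle_agents_def)
    have per: "(?g ^^ (m * n)) x = x" if "(?g ^^ m) x = x" for m n x
      using that by (induction n) (auto simp: funpow_add)
    have "(?g ^^ (k * l)) i = i" "(?g ^^ (k * l)) j = j"
      using per[of k i l] per[of l j k] k l by (simp_all add: mult.commute)
    moreover obtain m where "k * l = Suc m" using k l by (metis gr0_implies_Suc nat_0_less_mult_iff)
    ultimately have "(?g ^^ m) (?g i) = i" "(?g ^^ m) (?g j) = j"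
      by (simp_all only: funpow_Suc_right comp_apply)
    moreover have "?g i = ?g j" using eq t by simp
    ultimately show "i = j" by metis
  qed
  then have "bij ?f" by (simp add: bij_def finite_UNIV_inj_surj)
  moreover have "TTC \<omega> P = \<omega> \<circ> ?f" using T by auto
  ultimately show ?thesis
    using assms(1) by (simp add: allocations_def bij_comp)
qed

end

theory Submission
  imports Defs "HOL-Combinatorics.Transposition"
begin

text \<open>
  Uniqueness is shown round by round. Fix the set \<open>S\<close> of agents remaining at a profile, and
  suppose that the members of \<open>S\<close> share \<open>\<omega> ` S\<close> whatever they report. Every object on a cycle \<open>C\<close>
  of the pointing graph is top-ranked within \<open>\<omega> ` S\<close> by its predecessor, so the top-two condition
  lets each \<open>i \<in> C\<close> report its successor's object first and its own (or any other object of the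
  cycle) second. When each member reports its own object second, individual rationality leaves
  only full trade and no trade, and full trade follows by induction on \<open>card C\<close>: by letting \<open>i\<close>
  point to the successor \<open>\<sigma> (\<sigma> i)\<close> of its successor, one obtains a shorter cycle, so that \<open>i\<close> can
  secure the object of \<open>\<sigma> (\<sigma> i)\<close>; if \<open>i\<close> ranks it just below the object of \<open>\<sigma> i\<close> and still received
  it, then \<open>\<sigma> i\<close> would keep its own object and \<open>i\<close> and \<open>\<sigma> i\<close> would violate pair efficiency.
  Strategyproofness carries full trade over to the true preferences, one agent at a time.
\<close>

section \<open>Top-ranked objects\<close>

lemma strict_linear_order_asym:
  assumes "strict_linear_order r" "(a, b) \<in> r\<^sup>=" "(b, a) \<in> r\<^sup>="
  shows "a = b"
  using assms by (auto simp: strict_linear_order_on_def irrefl_def dest: transD)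

lemma ranked_1_top:
  assumes r: "strict_linear_order r" and A: "finite A" "b \<in> A"
  shows "(ranked 1 r A, b) \<in> r\<^sup>="
proof -
  let ?a = "ranked 1 r A"
  have "1 \<le> card A" using A by (metis One_nat_def Suc_leI card_gt_0_iff empty_iff)
  from theI'[OF ranked_ex1[OF r A(1) _ this]]
  have a: "?a \<in> A" "card {c \<in> A. (c, ?a) \<in> r\<^sup>=} = 1"
    by (simp_all add: ranked_def)
  from a(2) obtain x where "{c \<in> A. (c, ?a) \<in> r\<^sup>=} = {x}" by (auto simp: card_1_singleton_iff)
  moreover have "?a \<in> {c \<in> A. (c, ?a) \<in> r\<^sup>=}" using a(1) by simp
  ultimately have "{c \<in> A. (c, ?a) \<in> r\<^sup>=} = {?a}" by (metis singletonD)
  then have "(b, ?a) \<in> r \<Longrightarrow> b = ?a" using A(2) by blast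
  then show ?thesis using r by (auto simp: strict_linear_order_on_def total_on_def)
qed

lemma ranked_1_eqI:
  assumes "strict_linear_order r" "finite A" "a \<in> A" "\<And>b. b \<in> A \<Longrightarrow> (a, b) \<in> r\<^sup>="
  shows "ranked 1 r A = a"
proof (rule strict_linear_order_asym[OF assms(1)])
  show "(ranked 1 r A, a) \<in> r\<^sup>=" using assms by (intro ranked_1_top)
  show "(a, ranked 1 r A) \<in> r\<^sup>=" using assms by (intro assms(4) ranked_1_in) auto
qed

lemma ranked_1_subset:
  assumes "strict_linear_order r" "finite A" "B \<subseteq> A" "ranked 1 r A \<in> B"
  shows "ranked 1 r B = ranked 1 r A"
proof (rule ranked_1_eqI)
  fix b assume "b \<in> B"
  then show "(ranked 1 r A, b) \<in> r\<^sup>=" using assms by (intro ranked_1_top) auto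
qed (use assms in \<open>auto intro: finite_subset\<close>)

text \<open>Otherwise the top object, \<open>b\<close> and the second-ranked object would be three
  distinct objects weakly preferred to the second-ranked one, against the count of two.\<close>

lemma ranked_2_top:
  assumes r: "strict_linear_order r" and A: "finite A" "b \<in> A" "b \<noteq> ranked 1 r A"
  shows "(ranked 2 r A, b) \<in> r\<^sup>="
proof (rule ccontr)
  let ?t = "ranked 1 r A" and ?a = "ranked 2 r A"
  assume neg: "(?a, b) \<notin> r\<^sup>="
  have irr: "irrefl r" and tr: "trans r" and tot: "total r"
    using r by (auto simp: strict_linear_order_on_def)
  have t: "?t \<in> A" using ranked_1_in[OF r A(1)] A(2) by blast
  have "card {?t, b} \<le> card A" using A t by (intro card_mono) auto
  then have "2 \<le> card A" using A(3) by simp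
  from theI'[OF ranked_ex1[OF r A(1) _ this]]
  have a: "?a \<in> A" "card {c \<in> A. (c, ?a) \<in> r\<^sup>=} = 2"
    by (simp_all add: ranked_def)
  have tb: "(?t, b) \<in> r" using ranked_1_top[OF r A(1,2)] A(3) by auto
  have ba: "(b, ?a) \<in> r" using neg tot by (auto simp: total_on_def)
  have ta: "(?t, ?a) \<in> r" using tb ba tr by (auto dest: transD)
  have "card {?t, b, ?a} = 3"
    using tb ba ta irr by (auto simp: irrefl_def card_insert_if)
  moreover have "card {?t, b, ?a} \<le> card {c \<in> A. (c, ?a) \<in> r\<^sup>=}"
    using t A a tb ba ta by (intro card_mono) auto
  ultimately show False using a(2) by simp
qed

section \<open>Cycles as minimal invariant sets\<close>

text \<open>These sets are the cycles of \<open>f\<close>. The encoding avoids indices: a property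
  holds on all of \<open>C\<close> once the members having it form a nonempty set closed under
  \<open>f\<close>.\<close>

definition minimal_invariant :: "('a \<Rightarrow> 'a) \<Rightarrow> 'a set \<Rightarrow> bool" where
  "minimal_invariant f C \<longleftrightarrow>
     C \<noteq> {} \<and> f ` C \<subseteq> C \<and> (\<forall>G \<subseteq> C. G \<noteq> {} \<and> f ` G \<subseteq> G \<longrightarrow> G = C)"

lemma minimal_invariantD:
  assumes "minimal_invariant f C" "G \<subseteq> C" "G \<noteq> {}" "f ` G \<subseteq> G"
  shows "G = C"
  using assms by (simp add: minimal_invariant_def)

lemma minimal_invariant_image:
  assumes "minimal_invariant f C"
  shows "f ` C = C"
  by (rule minimal_invariantD[OF assms]) (use assms in \<open>auto simp: minimal_invariant_def\<close>)

lemma minimal_invariant_inj_on: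
  assumes "minimal_invariant f C" "finite C"
  shows "inj_on f C"
  using assms by (intro eq_card_imp_inj_on) (simp_all add: minimal_invariant_image)

lemma minimal_invariant_fixpoint:
  assumes "minimal_invariant f C" "x \<in> C" "f x = x"
  shows "C = {x}"
  using minimal_invariantD[of f C "{x}"] assms by simp

text \<open>Bypassing \<open>f x\<close> shortens a cycle by one, which drives the induction in
  \<open>cycle_trades\<close>. An invariant set of the new map must contain \<open>x\<close>, as it
  would otherwise be invariant under \<open>f\<close>; adding \<open>f x\<close> back makes it
  invariant under \<open>f\<close>, hence all of \<open>C\<close>.\<close>

lemma minimal_invariant_shortcut:
  assumes C: "minimal_invariant f C" "finite C" and x: "x \<in> C" "f x \<noteq> x"
  shows "minimal_invariant (f(x := f (f x))) (C - {f x})"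
  unfolding minimal_invariant_def
proof (intro conjI allI impI)
  let ?g = "f(x := f (f x))"
  have cl: "f y \<in> C" if "y \<in> C" for y using C(1) that by (auto simp: minimal_invariant_def)
  have inj: "inj_on f C" by (rule minimal_invariant_inj_on[OF C])
  \<comment> \<open>By injectivity equality would give \<open>f x = x\<close>; so the redirected
    arrow avoids the removed point.\<close>
  have "f (f x) \<noteq> f x" using inj_onD[OF inj _ cl x(1), of "x"] x by auto
  then show "?g ` (C - {f x}) \<subseteq> C - {f x}"
    using cl x inj_onD[OF inj] by auto
  show "C - {f x} \<noteq> {}" using x by auto
  fix G assume G: "G \<subseteq> C - {f x}" "G \<noteq> {} \<and> ?g ` G \<subseteq> G"
  have "x \<in> G"
  proof (rule ccontr)
    assume "x \<notin> G"
    then have "f ` G \<subseteq> G" using G by (auto split: if_splits)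
    then show False using minimal_invariantD[OF C(1), of G] G \<open>x \<notin> G\<close> x by auto
  qed
  have "f ` insert (f x) G \<subseteq> insert (f x) G"
  proof
    fix z assume "z \<in> f ` insert (f x) G"
    then consider "z = f (f x)" | y where "y \<in> G" "z = f y" by auto
    then show "z \<in> insert (f x) G"
    proof cases
      case 1 then show ?thesis using G \<open>x \<in> G\<close> by auto
    next
      case 2 then show ?thesis using G by (cases "y = x") (auto split: if_splits)
    qed
  qed
  then have "insert (f x) G = C"
    using G cl x by (intro minimal_invariantD[OF C(1)]) auto
  then show "G = C - {f x}" using G by auto
qed

lemma minimal_invariant_orbit:
  assumes "k > 0" "(f ^^ k) x = x"
  shows "minimal_invariant f (range (\<lambda>n. (f ^^ n) x))"
  unfolding minimal_invariant_def
proof (intro conjI allI impI)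
  show "f ` range (\<lambda>n. (f ^^ n) x) \<subseteq> range (\<lambda>n. (f ^^ n) x)"
    by clarify (metis comp_apply funpow.simps(2) rangeI)
  fix G assume G: "G \<subseteq> range (\<lambda>n. (f ^^ n) x)" "G \<noteq> {} \<and> f ` G \<subseteq> G"
  have iter: "(f ^^ m) y \<in> G" if "y \<in> G" for m y
    using that G by (induction m) auto
  obtain n where n: "(f ^^ n) x \<in> G" using G by auto
  have "(f ^^ (k * n)) x = x" using assms(2) by (induction n) (auto simp: funpow_add)
  \<comment> \<open>\<open>k * n\<close> is a multiple of the period and at least \<open>n\<close>,
    so \<open>k * n - n\<close> further steps lead from the \<open>n\<close>-th iterate back to
    \<open>x\<close>.\<close>
  moreover have "k * n = (k * n - n) + n" using assms(1) by simp
  ultimately have "(f ^^ (k * n - n)) ((f ^^ n) x) = x" by (metis comp_apply funpow_add)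
  then have "x \<in> G" using iter[OF n, of "k * n - n"] by simp
  then show "G = range (\<lambda>n. (f ^^ n) x)" using iter G by auto
qed simp

section \<open>Properties of TTC\<close>

locale market =
  fixes \<omega> :: "'i::finite \<Rightarrow> 'o"
  assumes bij_\<omega>: "bij \<omega>"
begin

lemma \<omega>_eq [simp]: "\<omega> i = \<omega> j \<longleftrightarrow> i = j"
  using bij_\<omega> by (auto simp: bij_def inj_def)

lemma \<omega>_in [simp]: "\<omega> i \<in> \<omega> ` S \<longleftrightarrow> i \<in> S"
  by auto

lemma ex_owner: "\<exists>i. a = \<omega> i"
  using bij_\<omega> by (metis bij_pointE)

context
  fixes P :: "'i \<Rightarrow> 'o rel"
  assumes slo: "\<And>i. strict_linear_order (P i)"
begin

lemmas points_to_in_S = points_to_in(1)[where P = P, OF bij_\<omega> slo]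
  and \<omega>_points_to = points_to_in(2)[where P = P, OF bij_\<omega> slo]

lemma points_to_top:
  assumes "j \<in> S"
  shows "(\<omega> (points_to \<omega> P S i), \<omega> j) \<in> (P i)\<^sup>="
proof -
  have "S \<noteq> {}" using assms by auto
  from \<omega>_points_to[OF this] show ?thesis
    using assms by (simp only: ranked_1_top[OF slo] \<omega>_in finite finite_imageI)
qed

text \<open>An arrow survives departures as long as its target stays, since a best object remains
  best in every subset containing it.\<close>

lemma points_to_subset:
  assumes "T \<subseteq> S" "points_to \<omega> P S i \<in> T"
  shows "points_to \<omega> P T i = points_to \<omega> P S i"
proof -
  have "S \<noteq> {}" using assms by auto
  then show ?thesis
    using ranked_1_subset[OF slo, of "\<omega> ` S" "\<omega> ` T" i] \<omega>_points_to[of S i] assms image_mono[of T S \<omega>]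
    unfolding points_to_def by (metis \<omega>_in finite finite_imageI)
qed

lemma points_to_cycle_agents:
  assumes "i \<in> cycle_agents \<omega> P S"
  shows "points_to \<omega> P S i \<in> cycle_agents \<omega> P S"
proof -
  obtain k where k: "k > 0" "(points_to \<omega> P S ^^ k) i = i" and i: "i \<in> S"
    using assms by (auto simp: cycle_agents_def)
  have "(points_to \<omega> P S ^^ k) (points_to \<omega> P S i) = points_to \<omega> P S i"
    by (metis funpow_swap1 k(2))
  with k(1) i points_to_in_S[of S i] show ?thesis by (auto simp: cycle_agents_def)
qed

lemma cycle_agents_cycle:
  assumes "i \<in> cycle_agents \<omega> P S"
  obtains C where "minimal_invariant (points_to \<omega> P S) C" "i \<in> C" "C \<subseteq> cycle_agents \<omega> P S"
proof -
  let ?f = "points_to \<omega> P S"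
  obtain k where k: "k > 0" "(?f ^^ k) i = i" using assms by (auto simp: cycle_agents_def)
  have "(?f ^^ n) i \<in> cycle_agents \<omega> P S" for n
    using assms points_to_cycle_agents by (induction n) auto
  moreover have "i \<in> range (\<lambda>n. (?f ^^ n) i)" by (metis funpow_0 rangeI)
  ultimately show ?thesis
    using that[OF minimal_invariant_orbit[OF k]] by auto
qed

text \<open>Surjectivity traces each departing agent back to the one that takes its object in the
  same round.\<close>

lemma points_to_image_cycle_agents: "points_to \<omega> P S ` cycle_agents \<omega> P S = cycle_agents \<omega> P S"
proof
  show "points_to \<omega> P S ` cycle_agents \<omega> P S \<subseteq> cycle_agents \<omega> P S"
    using points_to_cycle_agents by auto
  show "cycle_agents \<omega> P S \<subseteq> points_to \<omega> P S ` cycle_agents \<omega> P S"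
  proof
    fix i assume "i \<in> cycle_agents \<omega> P S"
    then obtain C where C: "minimal_invariant (points_to \<omega> P S) C" "i \<in> C" "C \<subseteq> cycle_agents \<omega> P S"
      by (rule cycle_agents_cycle)
    then show "i \<in> points_to \<omega> P S ` cycle_agents \<omega> P S"
      using minimal_invariant_image[OF C(1)] by blast
  qed
qed

lemma exit_round_cycle: "i \<in> cycle_agents \<omega> P (remaining \<omega> P (exit_round \<omega> P i))"
  unfolding exit_round_def by (rule theI'[OF exit_round_ex1[where P = P, OF bij_\<omega> slo]])

lemma exit_round_eq: "i \<in> cycle_agents \<omega> P (remaining \<omega> P t) \<Longrightarrow> exit_round \<omega> P i = t"
  unfolding exit_round_def by (rule the1_equality[OF exit_round_ex1[where P = P, OF bij_\<omega> slo]])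

lemma remaining_iff: "i \<in> remaining \<omega> P t \<longleftrightarrow> t \<le> exit_round \<omega> P i"
proof
  assume i: "i \<in> remaining \<omega> P t"
  show "t \<le> exit_round \<omega> P i"
  proof (rule ccontr)
    assume "\<not> t \<le> exit_round \<omega> P i"
    then have "remaining \<omega> P t \<subseteq> remaining \<omega> P (Suc (exit_round \<omega> P i))"
      by (intro remaining_antimono) simp
    then show False using exit_round_cycle i by auto
  qed
next
  assume "t \<le> exit_round \<omega> P i"
  moreover have "i \<in> remaining \<omega> P (exit_round \<omega> P i)"
    using exit_round_cycle[of i] by (simp add: cycle_agents_def)
  ultimately show "i \<in> remaining \<omega> P t" using remaining_antimono[of t "exit_round \<omega> P i" \<omega> P] by blast
qed

lemma TTC_points_to: "TTC \<omega> P i = \<omega> (points_to \<omega> P (remaining \<omega> P (exit_round \<omega> P i)) i)"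
proof -
  have "remaining \<omega> P (exit_round \<omega> P i) \<noteq> {}"
    using exit_round_cycle[of i] by (auto simp: cycle_agents_def)
  from \<omega>_points_to[OF this] show ?thesis by (simp only: TTC_def)
qed

lemma TTC_top:
  assumes "j \<in> remaining \<omega> P (exit_round \<omega> P i)"
  shows "(TTC \<omega> P i, \<omega> j) \<in> (P i)\<^sup>="
  using points_to_top[OF assms] by (simp only: TTC_points_to)

lemma TTC_in_remaining: "TTC \<omega> P i \<in> \<omega> ` remaining \<omega> P (exit_round \<omega> P i)"
proof -
  have "remaining \<omega> P (exit_round \<omega> P i) \<noteq> {}"
    using exit_round_cycle[of i] by (auto simp: cycle_agents_def)
  from points_to_in_S[OF this] show ?thesis by (simp only: TTC_points_to \<omega>_in)
qed

text \<open>The object of a departed agent went to its predecessor on the cycle, who left in the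
  same round. As \<open>x\<close> agrees with TTC there, injectivity of \<open>x\<close> keeps that
  object from \<open>i\<close>.\<close>

lemma agree_TTC_remaining:
  assumes x: "bij x" and agree: "\<And>j. j \<notin> remaining \<omega> P t \<Longrightarrow> x j = TTC \<omega> P j"
    and i: "i \<in> remaining \<omega> P t"
  shows "x i \<in> \<omega> ` remaining \<omega> P t"
proof -
  let ?R = "remaining \<omega> P"
  obtain m where m: "x i = \<omega> m" using ex_owner by blast
  have "m \<in> ?R t"
  proof (rule ccontr)
    assume "m \<notin> ?R t"
    let ?s = "exit_round \<omega> P m"
    have s: "?s < t" using \<open>m \<notin> ?R t\<close> by (simp add: remaining_iff)
    obtain j where j: "j \<in> cycle_agents \<omega> P (?R ?s)" "m = points_to \<omega> P (?R ?s) j"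
      using exit_round_cycle[of m] points_to_image_cycle_agents[of "?R ?s"] by blast
    have "exit_round \<omega> P j = ?s" using exit_round_eq[OF j(1)] .
    then have "j \<notin> ?R t" "x j = \<omega> m" using agree[of j] s j(2) by (auto simp: remaining_iff TTC_points_to)
    then show False using m x i by (metis bij_is_inj injD)
  qed
  with m show ?thesis by simp
qed

section \<open>Individual rationality and efficiency of TTC\<close>

lemma TTC_individually_rational: "(TTC \<omega> P i, \<omega> i) \<in> (P i)\<^sup>="
  using TTC_top[of i i] exit_round_cycle[of i] by (simp add: cycle_agents_def)

text \<open>Induction on rounds: once \<open>y\<close> agrees with TTC on the departed, the others
  share the remaining objects, and an agent leaving now already gets its best among these.\<close>

lemma TTC_undominated:
  assumes y: "bij y" "\<And>i. (y i, TTC \<omega> P i) \<in> (P i)\<^sup>="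
  shows "y = TTC \<omega> P"
proof -
  have "y i = TTC \<omega> P i" if "i \<notin> remaining \<omega> P t" for i t
    using that
  proof (induction t arbitrary: i)
    case (Suc t)
    show ?case
    proof (cases "i \<in> remaining \<omega> P t")
      case True
      then have t: "exit_round \<omega> P i = t"
        using Suc.prems by (intro exit_round_eq) auto
      obtain j where j: "j \<in> remaining \<omega> P t" "y i = \<omega> j"
        using agree_TTC_remaining[OF y(1) Suc.IH True] by auto
      have "(TTC \<omega> P i, y i) \<in> (P i)\<^sup>=" using TTC_top[of j i] j t by simp
      then show ?thesis using strict_linear_order_asym[OF slo] y(2) by metis
    qed (rule Suc.IH)
  qed simp
  \<comment> \<open>The round after the exit round of \<open>i\<close> serves as
    \<open>t\<close>.\<close>
  then show ?thesis using remaining_iff by (metis ext not_less_eq_eq order_refl)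
qed

section \<open>Strategyproofness of TTC\<close>

lemma points_to_other: "i \<noteq> j \<Longrightarrow> points_to \<omega> (P(j := r)) S i = points_to \<omega> P S i"
  by (simp add: points_to_def)

text \<open>A cycle depends only on the arrows of its members, and \<open>j\<close> is none of them.
  A new report of \<open>j\<close> may create further cycles, hence only an inclusion.\<close>

lemma cycle_agents_other:
  assumes "j \<notin> cycle_agents \<omega> P S"
  shows "cycle_agents \<omega> P S \<subseteq> cycle_agents \<omega> (P(j := r)) S"
proof
  fix i assume i: "i \<in> cycle_agents \<omega> P S"
  have cyc: "(points_to \<omega> P S ^^ n) i \<in> cycle_agents \<omega> P S" for n
    using i points_to_cycle_agents by (induction n) auto
  have "(points_to \<omega> (P(j := r)) S ^^ n) i = (points_to \<omega> P S ^^ n) i" for n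
  proof (induction n)
    case (Suc n)
    have "(points_to \<omega> P S ^^ n) i \<noteq> j" using cyc[of n] assms by auto
    from points_to_other[OF this] show ?case by (simp only: funpow.simps comp_apply Suc)
  qed simp
  with i show "i \<in> cycle_agents \<omega> (P(j := r)) S" by (simp add: cycle_agents_def)
qed

text \<open>
  Here \<open>g\<close> is the pointing map after a misreport by \<open>i\<close>. Members of \<open>M\<close> leaving before \<open>i\<close> would
  form a \<open>g\<close>-invariant set avoiding \<open>i\<close>, which the minimality of \<open>M\<close> excludes.
\<close>

lemma chain_persists:
  assumes M: "minimal_invariant g M" "i \<in> M" "M \<subseteq> remaining \<omega> P s"
    and g: "\<And>x. x \<in> M \<Longrightarrow> x \<noteq> i \<Longrightarrow> g x = points_to \<omega> P (remaining \<omega> P s) x"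
    and t: "s \<le> t" "t \<le> exit_round \<omega> P i"
  shows "M \<subseteq> remaining \<omega> P t"
  using t
proof (induction t rule: dec_induct)
  case base
  show ?case by (rule M(3))
next
  case (step u)
  let ?R = "remaining \<omega> P" and ?c = "cycle_agents \<omega> P (remaining \<omega> P u)"
  have Mu: "M \<subseteq> ?R u" using step by simp
  have i: "i \<notin> ?c" using step.prems exit_round_eq[of i u] by auto
  have inM: "g x \<in> M" if "x \<in> M" for x using M(1) that by (auto simp: minimal_invariant_def)
  \<comment> \<open>The targets lie in \<open>M\<close> and so are still present; these arrows have
    not moved since round \<open>s\<close>.\<close>
  have "points_to \<omega> P (?R u) x = g x" if "x \<in> M" "x \<noteq> i" for x
    using points_to_subset[OF remaining_antimono[OF step.hyps(1), of \<omega> P], of x] g[OF that] inM[OF that(1)] Mu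
    by auto
  then have "g ` (M \<inter> ?c) \<subseteq> M \<inter> ?c"
    using inM points_to_cycle_agents[of _ "?R u"] i by fastforce
  then have "M \<inter> ?c = {}"
    using minimal_invariantD[OF M(1), of "M \<inter> ?c"] i M(2) by auto
  then show ?case using Mu by auto
qed

end

text \<open>Both runs coincide up to the earlier exit of \<open>i\<close>. It then suffices that the
  object obtained by misreporting is still present when \<open>i\<close> leaves under
  \<open>P\<close>, where \<open>i\<close> takes the best one left.\<close>

lemma TTC_no_manipulation:
  assumes slo: "\<And>i. strict_linear_order (P i)" and r: "strict_linear_order r"
  shows "(TTC \<omega> P i, TTC \<omega> (P(i := r)) i) \<in> (P i)\<^sup>="
proof -
  let ?Q = "P(i := r)"
  let ?s = "exit_round \<omega> P i" and ?t = "exit_round \<omega> ?Q i"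
  have slo': "strict_linear_order (?Q j)" for j using slo r by simp
  note eqP = exit_round_eq[where P = P, OF slo] and eqQ = exit_round_eq[where P = ?Q, OF slo']
  have same: "remaining \<omega> P u = remaining \<omega> ?Q u" if "u \<le> ?s" "u \<le> ?t" for u
    using that
  proof (induction u)
    case (Suc u)
    let ?S = "remaining \<omega> ?Q u"
    have S: "remaining \<omega> P u = ?S" by (rule Suc.IH) (use Suc.prems in simp_all)
    have "i \<notin> cycle_agents \<omega> P ?S" "i \<notin> cycle_agents \<omega> ?Q ?S"
      using eqP[of i u] eqQ[of i u] Suc.prems S by auto
    \<comment> \<open>Changing the report of \<open>i\<close> back turns \<open>?Q\<close> into
      \<open>P\<close>, which gives the converse inclusion.\<close>
    then have "cycle_agents \<omega> P ?S = cycle_agents \<omega> ?Q ?S"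
      using cycle_agents_other[where P = P, OF slo, of i ?S r]
        cycle_agents_other[where P = ?Q, OF slo', of i ?S "P i"] by simp
    then show ?case using S by (simp del: fun_upd_apply)
  qed simp
  have "TTC \<omega> ?Q i \<in> \<omega> ` remaining \<omega> P ?s"
  proof (cases "?s \<le> ?t")
    case True
    have "TTC \<omega> ?Q i \<in> \<omega> ` remaining \<omega> ?Q ?t"
      by (rule TTC_in_remaining[where P = ?Q, OF slo'])
    then show ?thesis using remaining_antimono[OF True, of \<omega> ?Q] same[of ?s] True by auto
  next
    case False
    let ?S = "remaining \<omega> P ?t"
    have S: "remaining \<omega> ?Q ?t = ?S" using False same[of ?t] by simp
    \<comment> \<open>\<open>M\<close> is the cycle closed by the misreport. Its members other than
      \<open>i\<close> point alike under \<open>P\<close>, so this chain leading to \<open>i\<close>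
      stays until \<open>i\<close> leaves.\<close>
    obtain M where M: "minimal_invariant (points_to \<omega> ?Q ?S) M" "i \<in> M" "M \<subseteq> ?S"
      using cycle_agents_cycle[where P = ?Q, OF slo', of i ?S]
        exit_round_cycle[where P = ?Q, OF slo', of i] S
      by (metis (no_types, lifting) cycle_agents_def mem_Collect_eq subset_eq)
    have "M \<subseteq> remaining \<omega> P ?s"
      using chain_persists[where P = P, OF slo M, of ?s] False by (simp add: points_to_other[OF slo])
    moreover have "TTC \<omega> ?Q i = \<omega> (points_to \<omega> ?Q ?S i)"
      using TTC_points_to[where P = ?Q, OF slo', of i] S by simp
    moreover have "points_to \<omega> ?Q ?S i \<in> M" using M by (auto simp: minimal_invariant_def)
    ultimately show ?thesis by auto
  qed
  then obtain m where "m \<in> remaining \<omega> P ?s" "TTC \<omega> ?Q i = \<omega> m" by (rule imageE)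
  then show ?thesis using TTC_top[where P = P, OF slo, of m i] by simp
qed

end

section \<open>Uniqueness\<close>

locale pair_efficient_rule = market \<omega> for \<omega> :: "'i::finite \<Rightarrow> 'o" +
  fixes D :: "'o rel set" and \<phi> :: "('i \<Rightarrow> 'o rel) \<Rightarrow> 'i \<Rightarrow> 'o"
  assumes D: "D \<subseteq> preferences" and tt: "top_two D" and rule: "is_rule D \<phi>"
    and ir: "individually_rational \<omega> D \<phi>" and pe: "pair_efficient D \<phi>"
    and sp: "strategyproof D \<phi>"
begin

lemma slo_D: "r \<in> D \<Longrightarrow> strict_linear_order r"
  using D by (auto simp: preferences_def)

lemma slo_profile: "Q \<in> profiles D \<Longrightarrow> strict_linear_order (Q i)"
  using slo_D by (simp add: profiles_def)

lemma rule_eq [simp]: "Q \<in> profiles D \<Longrightarrow> \<phi> Q i = \<phi> Q j \<longleftrightarrow> i = j"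
  using rule by (auto simp: is_rule_def allocations_def bij_def inj_def)

lemma rule_rational: "Q \<in> profiles D \<Longrightarrow> (\<phi> Q i, \<omega> i) \<in> (Q i)\<^sup>="
  using ir by (simp add: individually_rational_def)

lemma rule_truthful:
  assumes "Q \<in> profiles D" "r \<in> D"
  shows "(\<phi> Q i, \<phi> (Q(i := r)) i) \<in> (Q i)\<^sup>="
proof -
  have "(\<phi> (Q(i := r)) i, \<phi> Q i) \<notin> Q i" using sp assms unfolding strategyproof_def by blast
  then show ?thesis
    using slo_profile[OF assms(1), of i] unfolding strict_linear_order_on_def total_on_def by blast
qed

text \<open>\<open>\<Q>\<close> lets the agents in \<open>S\<close> report anything in
  \<open>D\<close>, so that deviations by them do not leave the setting. In \<open>rule_TTC\<close>
  it consists of the profiles that agree with \<open>P\<close> on the departed agents.\<close>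

context
  fixes S :: "'i set" and \<Q> :: "('i \<Rightarrow> 'o rel) set"
  assumes prof: "\<Q> \<subseteq> profiles D"
    and upd: "\<And>Q i r. Q \<in> \<Q> \<Longrightarrow> i \<in> S \<Longrightarrow> r \<in> D \<Longrightarrow> Q(i := r) \<in> \<Q>"
    and stay: "\<And>Q i. Q \<in> \<Q> \<Longrightarrow> i \<in> S \<Longrightarrow> \<phi> Q i \<in> \<omega> ` S"
begin

lemma profile_in_D: "Q \<in> \<Q> \<Longrightarrow> Q i \<in> D"
  using prof by (auto simp: profiles_def)

lemma slo_Q: "Q \<in> \<Q> \<Longrightarrow> strict_linear_order (Q i)"
  using slo_D profile_in_D by blast

lemma eq_top:
  assumes "Q \<in> \<Q>" "i \<in> S" "(\<phi> Q i, ranked 1 (Q i) (\<omega> ` S)) \<in> (Q i)\<^sup>="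
  shows "\<phi> Q i = ranked 1 (Q i) (\<omega> ` S)"
  using assms(3) ranked_1_top[OF slo_Q finite_imageI stay, OF assms(1) finite assms(1,2)]
  by (rule strict_linear_order_asym[OF slo_Q[OF assms(1)]])

text \<open>Strategyproofness makes the truthful outcome at least as good as the top object, and
  \<open>stay\<close> rules out anything better.\<close>

lemma top_if_manipulable:
  assumes "Q \<in> \<Q>" "i \<in> S" "r \<in> D" "\<phi> (Q(i := r)) i = ranked 1 (Q i) (\<omega> ` S)"
  shows "\<phi> Q i = ranked 1 (Q i) (\<omega> ` S)"
  using assms rule_truthful[of Q r i] prof by (intro eq_top) auto

lemma second_or_top:
  assumes "Q \<in> \<Q>" "i \<in> S" "(\<phi> Q i, ranked 2 (Q i) (\<omega> ` S)) \<in> (Q i)\<^sup>="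
  shows "\<phi> Q i = ranked 2 (Q i) (\<omega> ` S) \<or> \<phi> Q i = ranked 1 (Q i) (\<omega> ` S)"
  using strict_linear_order_asym[OF slo_Q[OF assms(1)] assms(3)]
    ranked_2_top[OF slo_Q finite_imageI stay, OF assms(1) finite assms(1,2)] by blast

lemma top_two_preference:
  assumes "r \<in> D" "ranked 1 r (\<omega> ` S) = a" "r' \<in> D" "ranked 1 r' (\<omega> ` S) = b" "a \<noteq> b"
  obtains p where "p \<in> D" "ranked 1 p (\<omega> ` S) = a" "ranked 2 p (\<omega> ` S) = b"
proof -
  let ?f = "\<lambda>r. ranked 1 r (\<omega> ` S)"
  have "a \<in> ?f ` D" "b \<in> ?f ` D" using assms(1-4) by auto
  moreover have "top_two_within D (\<omega> ` S)" using tt by (simp only: top_two_def)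
  ultimately obtain p where "p \<in> D" "a = ?f p" "b = ranked 2 p (\<omega> ` S)"
    using assms(5) unfolding top_two_within_def by blast
  then show ?thesis using that by simp
qed

text \<open>If \<open>x\<close> takes the object of \<open>\<sigma> x\<close>, then
  \<open>\<sigma> x\<close> cannot keep it and must trade too, unless \<open>\<sigma> x = x\<close>.
  So the traders form an invariant set.\<close>

lemma full_trade:
  assumes C: "minimal_invariant \<sigma> C" and Q: "Q \<in> \<Q>"
    and opts: "\<And>i. i \<in> C \<Longrightarrow> \<phi> Q i = \<omega> i \<or> \<phi> Q i = \<omega> (\<sigma> i)"
    and one: "j \<in> C" "\<phi> Q j = \<omega> (\<sigma> j)" and i: "i \<in> C"
  shows "\<phi> Q i = \<omega> (\<sigma> i)"
proof -
  let ?G = "{i \<in> C. \<phi> Q i = \<omega> (\<sigma> i)}"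
  have "\<phi> Q (\<sigma> x) = \<omega> (\<sigma> (\<sigma> x))" "\<sigma> x \<in> C" if "x \<in> ?G" for x
  proof -
    show *: "\<sigma> x \<in> C" using C that by (auto simp: minimal_invariant_def)
    from opts[OF this] show "\<phi> Q (\<sigma> x) = \<omega> (\<sigma> (\<sigma> x))"
    proof
      assume "\<phi> Q (\<sigma> x) = \<omega> (\<sigma> x)"
      then have "\<phi> Q (\<sigma> x) = \<phi> Q x" using that by simp
      then have "\<sigma> x = x" using Q prof by auto
      then show ?thesis using that by simp
    qed
  qed
  then have "?G = C" using one by (intro minimal_invariantD[OF C]) auto
  then show ?thesis using i by blast
qed

text \<open>\<open>\<sigma>\<close> is a variable of its own rather than \<open>points_to\<close>,
  because the induction passes to a shortcut map together with a changed profile.\<close>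

lemma cycle_trades:
  assumes "minimal_invariant \<sigma> C" "C \<subseteq> S" "Q \<in> \<Q>"
    and "\<And>i. i \<in> C \<Longrightarrow> ranked 1 (Q i) (\<omega> ` S) = \<omega> (\<sigma> i)" and "i \<in> C"
  shows "\<phi> Q i = \<omega> (\<sigma> i)"
  using assms
proof (induction "card C" arbitrary: \<sigma> C Q i rule: less_induct)
  case less
  note C = less.prems(1) and CS = less.prems(2) and Q = less.prems(3) and top = less.prems(4)
  show ?case
  proof (cases "\<exists>x\<in>C. \<sigma> x = x")
    \<comment> \<open>For a self-loop individual rationality is enough.\<close>
    case True
    then have "C = {i}" "\<sigma> i = i" using minimal_invariant_fixpoint[OF C] less.prems(5) by auto
    then show ?thesis using eq_top[OF Q, of i] top[of i] CS rule_rational[of Q i] Q prof by auto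
  next
    case False
    have cl: "\<sigma> x \<in> C" if "x \<in> C" for x using C that by (auto simp: minimal_invariant_def)
    have "\<exists>r. r \<in> D \<and> ranked 1 r (\<omega> ` S) = \<omega> (\<sigma> x) \<and> ranked 2 r (\<omega> ` S) = \<omega> x" if "x \<in> C" for x
    proof -
      \<comment> \<open>The object of \<open>x\<close> is top for its predecessor \<open>y\<close>,
        as the top-two condition requires.\<close>
      have "x \<in> \<sigma> ` C" using minimal_invariant_image[OF C] that by simp
      then obtain y where y: "y \<in> C" "x = \<sigma> y" by (rule imageE)
      have "\<omega> (\<sigma> x) \<noteq> \<omega> (\<sigma> y)" using False that y(2) by auto
      from top_two_preference[OF profile_in_D[OF Q] top[OF that] profile_in_D[OF Q] top[OF y(1)] this]
      show ?thesis using y(2) by blast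
    qed
    then have "\<forall>x\<in>C. \<exists>r. r \<in> D \<and> ranked 1 r (\<omega> ` S) = \<omega> (\<sigma> x) \<and> ranked 2 r (\<omega> ` S) = \<omega> x"
      by (rule ballI)
    from bchoice[OF this] obtain p where p: "\<And>x. x \<in> C \<Longrightarrow> p x \<in> D"
      "\<And>x. x \<in> C \<Longrightarrow> ranked 1 (p x) (\<omega> ` S) = \<omega> (\<sigma> x)"
      "\<And>x. x \<in> C \<Longrightarrow> ranked 2 (p x) (\<omega> ` S) = \<omega> x"
      by blast
    \<comment> \<open>Members of \<open>T\<close> have returned to their reports in
      \<open>Q\<close>, the rest of the cycle reports \<open>p\<close>. The argument goes from
      \<open>P {}\<close> to \<open>P C\<close>, which is \<open>Q\<close>.\<close>
    define P where "P T = (\<lambda>x. if x \<in> C - T then p x else Q x)" for T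
    have PQ: "P T \<in> \<Q>" for T
    proof -
      have "(\<lambda>x. if x \<in> U then p x else Q x) \<in> \<Q>" if "U \<subseteq> C" for U
        using finite[of U] that
      proof (induction U rule: finite_induct)
        case (insert u U)
        have "(\<lambda>x. if x \<in> insert u U then p x else Q x) = (\<lambda>x. if x \<in> U then p x else Q x)(u := p u)"
          by (rule ext) simp
        moreover have "u \<in> C" "u \<in> S" using insert.prems CS by auto
        ultimately show ?case using upd[OF insert.IH _ p(1)] insert.prems by simp
      qed (simp add: Q)
      from this[of "C - T"] show ?thesis by (simp add: P_def)
    qed
    have opts: "\<phi> R x = \<omega> x \<or> \<phi> R x = \<omega> (\<sigma> x)" if "R \<in> \<Q>" "x \<in> C" "R x = p x" for R x
    proof -
      have x: "x \<in> S" and R: "R \<in> profiles D" using that CS prof by auto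
      have "ranked 1 (R x) (\<omega> ` S) = \<omega> (\<sigma> x)" "ranked 2 (R x) (\<omega> ` S) = \<omega> x"
        using p(2,3)[OF that(2)] that(3) by simp_all
      then show ?thesis
        using second_or_top[OF that(1) x] rule_rational[OF R, of x] by simp
    qed
    have base: "\<phi> (P {}) x = \<omega> (\<sigma> x)" if "x \<in> C" for x
    proof -
      let ?P = "P {}"
      have P: "?P y = p y" if "y \<in> C" for y using that by (simp add: P_def)
      define j where "j = \<sigma> x"
      have j: "j \<in> C" "\<sigma> x = j" "j \<noteq> x" "\<sigma> j \<in> C" "\<sigma> j \<noteq> j"
        using cl that False by (auto simp: j_def)
      have xS: "x \<in> S" "j \<in> S" using that j CS by auto
      \<comment> \<open>Reporting \<open>p j\<close> makes \<open>x\<close> point past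
        \<open>j\<close>, and the shorter cycle trades by the induction hypothesis.\<close>
      have short: "\<phi> (?P(x := p j)) x = \<omega> (\<sigma> j)"
      proof -
        have "\<phi> (?P(x := p j)) x = \<omega> ((\<sigma>(x := \<sigma> (\<sigma> x))) x)"
        proof (rule less.hyps[of "C - {\<sigma> x}" "\<sigma>(x := \<sigma> (\<sigma> x))"])
          show "card (C - {\<sigma> x}) < card C" by (rule card_Diff1_less) (use j in auto)
          show "minimal_invariant (\<sigma>(x := \<sigma> (\<sigma> x))) (C - {\<sigma> x})"
            by (rule minimal_invariant_shortcut[OF C finite that]) (use j in simp)
          show "?P(x := p j) \<in> \<Q>" by (rule upd[OF PQ xS(1) p(1)[OF j(1)]])
          fix y assume "y \<in> C - {\<sigma> x}"
          then show "ranked 1 ((?P(x := p j)) y) (\<omega> ` S) = \<omega> ((\<sigma>(x := \<sigma> (\<sigma> x))) y)"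
            using p(2) j P by auto
        qed (use CS that j in auto)
        then show ?thesis using j by simp
      qed
      \<comment> \<open>\<open>r\<close> ranks the desired object first and the one secured by
        reporting \<open>p j\<close> second, so strategyproofness leaves only these two.\<close>
      have "\<omega> j \<noteq> \<omega> (\<sigma> j)" using j by simp
      from top_two_preference[OF p(1)[OF that] p(2)[OF that, unfolded j(2)] p(1)[OF j(1)] p(2)[OF j(1)] this]
      obtain r where r: "r \<in> D" "ranked 1 r (\<omega> ` S) = \<omega> j" "ranked 2 r (\<omega> ` S) = \<omega> (\<sigma> j)"
        by blast
      define R where "R = ?P(x := r)"
      have "R \<in> \<Q>" unfolding R_def by (rule upd[OF PQ xS(1) r(1)])
      with prof have R: "R \<in> \<Q>" "R \<in> profiles D" by auto
      have "(\<phi> R x, ranked 2 (R x) (\<omega> ` S)) \<in> (R x)\<^sup>="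
        using rule_truthful[OF R(2) p(1)[OF j(1)], of x] short r by (simp add: R_def)
      then have "\<phi> R x = \<omega> (\<sigma> j) \<or> \<phi> R x = \<omega> j"
        using second_or_top[OF R(1) xS(1)] r by (simp add: R_def)
      moreover have "\<phi> R x \<noteq> \<omega> (\<sigma> j)"
      proof
        assume x: "\<phi> R x = \<omega> (\<sigma> j)"
        have Rj: "R j = p j" using j P by (simp add: R_def)
        have "\<phi> R j \<noteq> \<phi> R x" using R j by simp
        then have jj: "\<phi> R j = \<omega> j" using opts[OF R(1) j(1) Rj] x by simp
        have "(\<omega> j, \<omega> (\<sigma> j)) \<in> r\<^sup>="
          using ranked_1_top[OF slo_D[OF r(1)], of "\<omega> ` S" "\<omega> (\<sigma> j)"] r(2) CS j by auto
        moreover have "(\<omega> (\<sigma> j), \<omega> j) \<in> (p j)\<^sup>="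
          using ranked_1_top[OF slo_D[OF p(1)[OF j(1)]], of "\<omega> ` S" "\<omega> j"] p(2)[OF j(1)] xS by auto
        ultimately have "(\<phi> R j, \<phi> R x) \<in> R x" "(\<phi> R x, \<phi> R j) \<in> R j"
          using x jj j Rj by (auto simp: R_def)
        then show False using pe R(2) by (auto simp: pair_efficient_def)
      qed
      ultimately have "\<phi> (?P(x := r)) x = \<omega> j" by (simp add: R_def)
      \<comment> \<open>\<open>p x\<close> and \<open>r\<close> have the same top object, and
        deviating to \<open>r\<close> obtains it.\<close>
      then have "\<phi> ?P x = \<omega> j"
        using top_if_manipulable[OF PQ xS(1) r(1), of "{}"] P p(2) that j by simp
      then show ?thesis using j by simp
    qed
    \<comment> \<open>For \<open>y\<close> in \<open>T\<close>, the smaller set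
      \<open>T - {y}\<close> shows that \<open>y\<close> gets its top object by reporting
      \<open>p y\<close>, hence also by reporting \<open>Q y\<close>. The rest of the cycle follows
      by \<open>full_trade\<close>.\<close>
    have full: "\<phi> (P T) x = \<omega> (\<sigma> x)" if "T \<subseteq> C" "x \<in> C" for T x
      using finite[of T] that
    proof (induction T arbitrary: x rule: finite_psubset_induct)
      case (psubset T)
      show ?case
      proof (cases "T = {}")
        case True
        then show ?thesis using base psubset.prems by simp
      next
        case False
        have T: "\<phi> (P T) y = \<omega> (\<sigma> y)" if "y \<in> T" for y
        proof -
          have y: "y \<in> C" "y \<in> S" using that psubset.prems CS by auto
          have *: "P (T - {y}) = (P T)(y := p y)" "P T y = Q y"
            using that y by (auto simp: P_def fun_eq_iff)
          have "\<phi> (P (T - {y})) y = \<omega> (\<sigma> y)"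
            using that psubset.prems by (intro psubset.IH) auto
          then show ?thesis
            using top_if_manipulable[OF PQ y(2) p(1)[OF y(1)], of T] * top[OF y(1)] by simp
        qed
        obtain y where "y \<in> T" using False by blast
        moreover have "\<phi> (P T) z = \<omega> z \<or> \<phi> (P T) z = \<omega> (\<sigma> z)" if "z \<in> C" for z
          using T opts[OF PQ that, of T] that by (cases "z \<in> T") (auto simp: P_def)
        ultimately show ?thesis
          using T psubset.prems by (intro full_trade[OF C PQ, of T y x]) auto
      qed
    qed
    have "P C = Q" by (auto simp: P_def)
    then show ?thesis using full[of C i] less.prems(5) by simp
  qed
qed

end

text \<open>The induction on rounds treats all profiles in \<open>\<Q> t\<close>, not just
  \<open>P\<close>: the departed must get their TTC objects whatever the remaining agents
  report.\<close>

lemma rule_TTC: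
  assumes P: "P \<in> profiles D"
  shows "\<phi> P = TTC \<omega> P"
proof -
  note slo = slo_profile[OF P]
  let ?R = "remaining \<omega> P"
  define \<Q> where "\<Q> t = {Q \<in> profiles D. \<forall>j. j \<notin> ?R t \<longrightarrow> Q j = P j}" for t
  have "\<phi> Q i = TTC \<omega> P i" if "Q \<in> \<Q> t" "i \<notin> ?R t" for Q i t
    using that
  proof (induction t arbitrary: Q i)
    case (Suc t)
    have sub: "\<Q> (Suc t) \<subseteq> \<Q> t" by (auto simp: \<Q>_def)
    show ?case
    proof (cases "i \<in> ?R t")
      case True
      let ?f = "points_to \<omega> P (?R t)"
      have i: "i \<in> cycle_agents \<omega> P (?R t)" using True Suc.prems by auto
      then obtain C where C: "minimal_invariant ?f C" "i \<in> C" "C \<subseteq> cycle_agents \<omega> P (?R t)"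
        using cycle_agents_cycle[where P = P, OF slo] by blast
      have "\<phi> Q i = \<omega> (?f i)"
      proof (rule cycle_trades[where \<Q> = "\<Q> t" and S = "?R t" and C = C])
        show "\<Q> t \<subseteq> profiles D" by (auto simp: \<Q>_def)
        show "Q(i := r) \<in> \<Q> t" if "Q \<in> \<Q> t" "i \<in> ?R t" "r \<in> D" for Q i r
          using that by (auto simp: \<Q>_def profiles_def)
        \<comment> \<open>By the induction hypothesis the departed hold their TTC objects, so the
          others share what is left.\<close>
        show "\<phi> Q i \<in> \<omega> ` ?R t" if "Q \<in> \<Q> t" "i \<in> ?R t" for Q i
          using that rule Suc.IH[of Q]
          by (intro agree_TTC_remaining[where P = P, OF slo])
            (auto simp: \<Q>_def is_rule_def allocations_def)
        show "ranked 1 (Q j) (\<omega> ` ?R t) = \<omega> (?f j)" if "j \<in> C" for j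
        proof -
          have "?R t \<noteq> {}" using True by blast
          \<comment> \<open>Cycle members leave in round \<open>t\<close>, so
            \<open>\<Q> (Suc t)\<close> fixes their reports.\<close>
          moreover have "Q j = P j" using Suc.prems(1) that C(3) by (auto simp: \<Q>_def)
          ultimately show ?thesis using \<omega>_points_to[where P = P, OF slo, of "?R t" j] by simp
        qed
        show "C \<subseteq> ?R t" using C(3) by (auto simp: cycle_agents_def)
      qed (use C Suc.prems sub in auto)
      then show ?thesis
        using exit_round_eq[where P = P, OF slo i] TTC_points_to[where P = P, OF slo, of i] by simp
    qed (use Suc sub in blast)
  qed simp
  moreover have "P \<in> \<Q> t" for t using P by (simp add: \<Q>_def)
  ultimately show ?thesis
    using remaining_iff[where P = P, OF slo] by (metis ext not_less_eq_eq order_refl)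
qed

end

section \<open>The axioms for TTC and the equivalence\<close>

lemma TTC_satisfies_axioms:
  fixes \<omega> :: "'i::finite \<Rightarrow> 'o"
  assumes "bij \<omega>" "D \<subseteq> preferences" and TTC: "\<And>P. P \<in> profiles D \<Longrightarrow> \<phi> P = TTC \<omega> P"
  shows "individually_rational \<omega> D \<phi>" "pareto_efficient D \<phi>" "strategyproof D \<phi>"
proof -
  interpret market \<omega> by unfold_locales fact
  have slo: "strict_linear_order (P i)" if "P \<in> profiles D" for P :: "'i \<Rightarrow> 'o rel" and i
    using that assms(2) by (auto simp: profiles_def preferences_def)
  have irr: "(a, a) \<notin> P i" if "P \<in> profiles D" for P :: "'i \<Rightarrow> 'o rel" and i a
    using slo[OF that] by (auto simp: strict_linear_order_on_def irrefl_def)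
  show "individually_rational \<omega> D \<phi>"
    unfolding individually_rational_def
    using TTC TTC_individually_rational slo by metis
  show "pareto_efficient D \<phi>"
    unfolding pareto_efficient_def
  proof (intro ballI notI, elim bexE conjE exE)
    fix P y j
    assume *: "P \<in> profiles D" "y \<in> allocations" "\<forall>i. (y i, \<phi> P i) \<in> (P i)\<^sup>=" "(y j, \<phi> P j) \<in> P j"
    then have "y = \<phi> P"
      using TTC_undominated[where P = P and y = y] slo TTC by (auto simp: allocations_def)
    with * irr show False by metis
  qed
  show "strategyproof D \<phi>"
    unfolding strategyproof_def
  proof (intro ballI notI, elim bexE exE)
    fix P i r
    assume *: "P \<in> profiles D" "r \<in> D" "(\<phi> (P(i := r)) i, \<phi> P i) \<in> P i"
    have "P(i := r) \<in> profiles D" using * by (simp add: profiles_def)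
    then have "(\<phi> P i, \<phi> (P(i := r)) i) \<in> (P i)\<^sup>="
      using TTC_no_manipulation[where P = P and r = r and i = i] slo[OF *(1)] TTC * assms(2)
      by (auto simp: preferences_def)
    then have "\<phi> P i = \<phi> (P(i := r)) i"
      using *(3) strict_linear_order_asym[OF slo[OF *(1)]] by blast
    with * irr show False by metis
  qed
qed

text \<open>Swapping the objects of a blocking pair is a Pareto improvement.\<close>

lemma pareto_efficient_imp_pair_efficient:
  fixes \<phi> :: "('i \<Rightarrow> 'o rel) \<Rightarrow> 'i \<Rightarrow> 'o"
  assumes rule: "is_rule D \<phi>" and pe: "pareto_efficient D \<phi>"
  shows "pair_efficient D \<phi>"
  unfolding pair_efficient_def
proof (intro ballI notI, elim exE conjE)
  fix P :: "'i \<Rightarrow> 'o rel" and i j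
  assume *: "P \<in> profiles D" "(\<phi> P j, \<phi> P i) \<in> P i" "(\<phi> P i, \<phi> P j) \<in> P j"
  let ?y = "\<phi> P \<circ> transpose i j"
  have "?y \<in> allocations"
    using rule * by (auto simp: is_rule_def allocations_def intro: bij_comp)
  moreover have "(?y k, \<phi> P k) \<in> (P k)\<^sup>=" for k
    using * by (auto simp: transpose_def)
  moreover have "(?y i, \<phi> P i) \<in> P i" using * by simp
  ultimately show False using pe * unfolding pareto_efficient_def by blast
qed

theorem theorem1:
  fixes \<omega> :: "'i::finite \<Rightarrow> 'o"
    and D :: "'o rel set"
    and \<phi> :: "('i \<Rightarrow> 'o rel) \<Rightarrow> 'i \<Rightarrow> 'o"
  assumes "bij \<omega>"
    and "D \<subseteq> preferences"
    and "top_two D"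
    and "is_rule D \<phi>"
  shows "((\<forall>P \<in> profiles D. \<phi> P = TTC \<omega> P) \<longleftrightarrow>
            individually_rational \<omega> D \<phi> \<and> pareto_efficient D \<phi> \<and> strategyproof D \<phi>) \<and>
         (individually_rational \<omega> D \<phi> \<and> pareto_efficient D \<phi> \<and> strategyproof D \<phi> \<longleftrightarrow>
            individually_rational \<omega> D \<phi> \<and> pair_efficient D \<phi> \<and> strategyproof D \<phi>)"
proof -
  let ?ii = "individually_rational \<omega> D \<phi> \<and> pareto_efficient D \<phi> \<and> strategyproof D \<phi>"
  let ?iii = "individually_rational \<omega> D \<phi> \<and> pair_efficient D \<phi> \<and> strategyproof D \<phi>"
  \<comment> \<open>The equivalences follow from the circle (i) to (ii) to (iii) to (i).\<close>
  have "?ii" if "\<forall>P \<in> profiles D. \<phi> P = TTC \<omega> P"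
    using TTC_satisfies_axioms[OF assms(1,2), of \<phi>] that by blast
  moreover have "?ii \<Longrightarrow> ?iii"
    using pareto_efficient_imp_pair_efficient[OF assms(4)] by blast
  moreover have "\<forall>P \<in> profiles D. \<phi> P = TTC \<omega> P" if ?iii
  proof -
    interpret pair_efficient_rule \<omega> D \<phi>
      by unfold_locales (use assms that in auto)
    show ?thesis using rule_TTC by blast
  qed
  ultimately show ?thesis by blast
qed

end
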